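(* Let $C_{1},\ldots,C_{m}\in\mathbb{R}_{+}^{n\times n}$ be pairwise comparison matrices with nonzero spectral radii, and let $B\in\mathbb{R}_{+}^{n\times n}$ be a matrix such that $\mathrm{Tr}(B)\leq 1$ (all matrix operations are in max-algebra). Consider the multiobjective problem of minimizing $(x^{-}C_{1}x,\ldots,x^{-}C_{m}x)$ over regular vectors $x\in\mathbb{R}_{+}^{n}$ subject to $Bx\leq x$. Define $$A=\bigoplus_{l=1}^{m}C_{l},\qquad \theta=\bigoplus_{k=1}^{n}\ \bigoplus_{0\leq i_{1}+\cdots+i_{k}\leq n-k}\mathrm{tr}^{1/k}(AB^{i_{1}}\cdots AB^{i_{k}}),\qquad B_{1}=\theta^{-1}A\oplus B,$$ where $i_1,\ldots,i_k$ range over nonnegative integers. Then, with $G=B_{1}^{\ast}$ and $g_1,\ldots,g_n$ the columns of $G$, the following statements hold: (i) All max-ordering solutions of the problem are given in the parametric form $x=Gu$, $u\in\mathbb{R}_+^n$, $u\neq 0$. (ii) The minimal normalized best differentiating solution is given by $$x^{\mathrm{best}}=g_{k}\|g_{k}\|^{-1},\qquad k\in\arg\max_{1\leq j\leq n}\|g_{j}\|\,\|g_{j}^{-}\|.$$ (iii) The maximal normalized worst differentiating solution is $x^{\mathrm{worst}}=(\mathbf{1}^{T}G)^{-}$.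
   Context: Max-algebra: the set $\mathbb{R}_{+}$ of nonnegative reals with addition $a\oplus b=\max(a,b)$ and the usual multiplication. Matrices and vectors over $\mathbb{R}_+$ are added and multiplied by the usual rules with $+$ replaced by $\oplus$; inequalities are entrywise; $I$ is the usual identity matrix; $A^{0}=I$, $A^{p}=AA^{p-1}$ for integers $p\geq 1$. A vector is regular if it has no zero entries. $\mathbf{1}=(1,\ldots,1)^{T}$. The conjugate of a nonzero matrix $A=(a_{ij})$ is $A^{-}=(a^{-}_{ij})$, of transposed size, with $a^{-}_{ij}=a_{ji}^{-1}$ if $a_{ji}\neq 0$ and $0$ otherwise (likewise for row and column vectors). $\|x\|=\max_{j}x_{j}$ for row or column vectors. For $A=(a_{ij})\in\mathbb{R}_+^{n\times n}$: $\mathrm{tr}A=\bigoplus_{k}a_{kk}$; $\mathrm{tr}^{1/k}(A)=(\mathrm{tr}A)^{1/k}$; $\mathrm{Tr}(A)=\bigoplus_{k=1}^{n}\mathrm{tr}A^{k}$; the spectral radius is $\bigoplus_{k=1}^{n}\mathrm{tr}^{1/k}(A^{k})$; if $\mathrm{Tr}(A)\leq 1$, the Kleene star is $A^{\ast}=\bigoplus_{k=0}^{n-1}A^{k}$. A pairwise comparison matrix is a matrix $C=(c_{ij})$ with $c_{ij}>0$ and $c_{ij}=1/c_{ji}$ for all $i,j$. Max-ordering solutions: the regular vectors $x$ with $Bx\leq x$ that minimize $\max_{1\leq l\leq m}x^{-}C_{l}x$ among all such vectors. Let $X$ be the set of max-ordering solutions. A normalized best (respectively worst) differentiating solution is a vector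 that maximizes (respectively minimizes) $x^{-}\mathbf{1}=\max_i x_i^{-1}$ over all $x\in X$ with $\mathbf{1}^{T}x=\max_i x_i=1$. The maximal worst differentiating solution is the worst differentiating solution that is entrywise $\geq$ every other one. The minimal best differentiating solution is "given by" a finite set $S$ of vectors in the following sense: each vector of $S$ is a normalized best differentiating solution, and every normalized best differentiating solution is entrywise $\geq$ some vector of $S$; if $S$ has an entrywise least element, that is the unique minimal best differentiating solution, and otherwise the minimal solution is not uniquely determined. *)

theory Defs
  imports "HOL-Analysis.Analysis"
begin

text \<open>
  Elements, vectors and matrices over the max-algebra of nonnegative reals are rendered over the
  type of reals, with nonnegativity stated as \<open>0 \<le> x\<close> in the entrywise order of the library.
  Every maximum below is over a finite nonempty set of reals, so \<^const>\<open>Max\<close> is meaningful.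
  Row and column vectors share the type \<open>real ^ 'n\<close>; the side from which a vector
  multiplies a matrix is visible in the product used.
\<close>

definition max_add :: "real^'n^'m \<Rightarrow> real^'n^'m \<Rightarrow> real^'n^'m" (infixl "\<oplus>" 65) where
  "A \<oplus> B = (\<chi> i j. max (A $ i $ j) (B $ i $ j))"

definition max_sum :: "('a \<Rightarrow> real^'n^'m) \<Rightarrow> 'a set \<Rightarrow> real^'n^'m" where
  "max_sum F S = (\<chi> i j. MAX l\<in>S. F l $ i $ j)"

definition max_mult :: "real^'p^'m \<Rightarrow> real^'n^'p \<Rightarrow> real^'n^'m" (infixl "\<otimes>" 70) where
  "A \<otimes> B = (\<chi> i j. MAX k. A $ i $ k * B $ k $ j)"

definition max_mult_vec :: "real^'n^'m \<Rightarrow> real^'n \<Rightarrow> real^'m" (infixr "\<otimes>v" 70) where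
  "A \<otimes>v x = (\<chi> i. MAX k. A $ i $ k * x $ k)"

definition vec_max_mult :: "real^'m \<Rightarrow> real^'n^'m \<Rightarrow> real^'n" (infixl "v\<otimes>" 70) where
  "x v\<otimes> A = (\<chi> j. MAX k. x $ k * A $ k $ j)"

text \<open>A row vector times a column vector.\<close>

definition max_dot :: "real^'n \<Rightarrow> real^'n \<Rightarrow> real" (infix "\<odot>" 70) where
  "x \<odot> y = (MAX k. x $ k * y $ k)"

primrec max_pow :: "real^'n^'n \<Rightarrow> nat \<Rightarrow> real^'n^'n" where
  "max_pow A 0 = mat 1"
| "max_pow A (Suc p) = A \<otimes> max_pow A p"

definition max_tr :: "real^'n^'n \<Rightarrow> real" where
  "max_tr A = (MAX k. A $ k $ k)"

definition max_Tr :: "real^'n^'n \<Rightarrow> real" where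
  "max_Tr A = (MAX k\<in>{1..CARD('n)}. max_tr (max_pow A k))"

definition max_spectral_radius :: "real^'n^'n \<Rightarrow> real" where
  "max_spectral_radius A = (MAX k\<in>{1..CARD('n)}. root k (max_tr (max_pow A k)))"

text \<open>Intended only for matrices with \<open>max_Tr A \<le> 1\<close>.\<close>

definition kleene_star :: "real^'n^'n \<Rightarrow> real^'n^'n" where
  "kleene_star A = max_sum (max_pow A) {0..CARD('n) - 1}"

definition regular :: "real^'n \<Rightarrow> bool" where
  "regular x \<longleftrightarrow> (\<forall>i. x $ i \<noteq> 0)"

text \<open>Conjugate of a row or column vector; a zero entry is sent to zero because
  \<open>inverse 0 = 0\<close>.\<close>

definition conj_vec :: "real^'n \<Rightarrow> real^'n" where
  "conj_vec x = (\<chi> i. inverse (x $ i))"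

definition max_norm :: "real^'n \<Rightarrow> real" where
  "max_norm x = (MAX j. x $ j)"

definition pairwise_comparison :: "real^'n^'n \<Rightarrow> bool" where
  "pairwise_comparison C \<longleftrightarrow> (\<forall>i j. C $ i $ j > 0 \<and> C $ i $ j = 1 / C $ j $ i)"

text \<open>The word \<open>A B^i\<^sub>1 \<cdots> A B^i\<^sub>k\<close> for the list of exponents \<open>[i\<^sub>1, \<dots>, i\<^sub>k]\<close>.\<close>

definition max_word :: "real^'n^'n \<Rightarrow> real^'n^'n \<Rightarrow> nat list \<Rightarrow> real^'n^'n" where
  "max_word A B is = foldr (\<lambda>i M. (A \<otimes> max_pow B i) \<otimes> M) is (mat 1)"

definition theta :: "real^'n^'n \<Rightarrow> real^'n^'n \<Rightarrow> real" where
  "theta A B = (MAX k\<in>{1..CARD('n)}.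
     MAX is\<in>{is. length is = k \<and> sum_list is \<le> CARD('n) - k}. root k (max_tr (max_word A B is)))"

definition feasible :: "real^'n^'n \<Rightarrow> real^'n \<Rightarrow> bool" where
  "feasible B x \<longleftrightarrow> 0 \<le> x \<and> regular x \<and> B \<otimes>v x \<le> x"

definition max_ordering_solution ::
    "nat \<Rightarrow> (nat \<Rightarrow> real^'n^'n) \<Rightarrow> real^'n^'n \<Rightarrow> real^'n \<Rightarrow> bool" where
  "max_ordering_solution m C B =
     is_arg_min (\<lambda>x. MAX l\<in>{1..m}. conj_vec x \<odot> (C l \<otimes>v x)) (feasible B)"

definition best_differentiating :: "(real^'n) set \<Rightarrow> real^'n \<Rightarrow> bool" where
  "best_differentiating X = is_arg_max (\<lambda>x. conj_vec x \<odot> 1) (\<lambda>x. x \<in> X \<and> 1 \<odot> x = 1)"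

definition worst_differentiating :: "(real^'n) set \<Rightarrow> real^'n \<Rightarrow> bool" where
  "worst_differentiating X = is_arg_min (\<lambda>x. conj_vec x \<odot> 1) (\<lambda>x. x \<in> X \<and> 1 \<odot> x = 1)"

definition least_such :: "('a::order \<Rightarrow> bool) \<Rightarrow> 'a \<Rightarrow> bool" where
  "least_such P x \<longleftrightarrow> P x \<and> (\<forall>y. P y \<longrightarrow> x \<le> y)"

definition greatest_such :: "('a::order \<Rightarrow> bool) \<Rightarrow> 'a \<Rightarrow> bool" where
  "greatest_such P x \<longleftrightarrow> P x \<and> (\<forall>y. P y \<longrightarrow> y \<le> x)"

definition minimal_such :: "('a::order \<Rightarrow> bool) \<Rightarrow> 'a \<Rightarrow> bool" where
  "minimal_such P x \<longleftrightarrow> P x \<and> (\<forall>y. P y \<and> y \<le> x \<longrightarrow> y = x)"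

text \<open>
  The minimal element with property \<open>P\<close> is given by the finite set \<open>S\<close>: the elements of \<open>S\<close> have
  the property, and everything having it lies above some element of \<open>S\<close>. If \<open>S\<close> has a least
  element, this is the only minimal element; otherwise there is no unique minimal element.
\<close>

definition minimal_given_by :: "('a::order \<Rightarrow> bool) \<Rightarrow> 'a set \<Rightarrow> bool" where
  "minimal_given_by P S \<longleftrightarrow>
     finite S \<and>
     (\<forall>s\<in>S. P s) \<and>
     (\<forall>x. P x \<longrightarrow> (\<exists>s\<in>S. s \<le> x)) \<and>
     (\<forall>s. least_such (\<lambda>s. s \<in> S) s \<longrightarrow> (\<forall>x. minimal_such P x \<longleftrightarrow> x = s)) \<and>
     ((\<nexists>s. least_such (\<lambda>s. s \<in> S) s) \<longrightarrow> \<not> (\<exists>!x. minimal_such P x))"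

end

theory Submission
  imports Defs
begin

text \<open>
  The value \<open>\<theta>\<close> bounds the objective from below, since \<open>A x \<le> \<mu> x\<close> and \<open>B x \<le> x\<close> give
  \<open>W x \<le> \<mu>\<^sup>k x\<close> for every word \<open>W\<close> with \<open>k\<close> letters \<open>A\<close>, so that \<open>\<mu>\<^sup>k\<close> dominates its diagonal.
  Conversely, a closed walk of \<open>B\<^sub>1\<close> with \<open>k \<ge> 1\<close> edges from \<open>A\<close> is, up to rotation, a closed walk
  of such a word scaled by \<open>\<theta>\<close> to the power \<open>-k\<close>, hence \<open>max_Tr B\<^sub>1 \<le> 1\<close>, and the columns of the
  Kleene star \<open>G\<close> attain \<open>\<theta>\<close>. The solutions are therefore the positive \<open>x\<close> with \<open>B\<^sub>1 x \<le> x\<close>,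
  equivalently \<open>G x \<le> x\<close>. The latter reads \<open>x \<ge> x\<^sub>k g\<^sub>k\<close> for all \<open>k\<close>: choosing \<open>k\<close> with \<open>x\<^sub>k = 1\<close>
  bounds a normalized solution from below by a column, and evaluating it at a largest entry of
  \<open>g\<^sub>k\<close> bounds \<open>x\<^sub>k\<close> from above by the inverse of that entry.
\<close>

subsection \<open>Max-algebra of nonnegative matrices\<close>

lemma max_mult_le_iff: "(A \<otimes> B) $ i $ j \<le> c \<longleftrightarrow> (\<forall>k. A $ i $ k * B $ k $ j \<le> c)"
  by (auto simp: max_mult_def)

lemma max_mult_upper: "A $ i $ k * B $ k $ j \<le> (A \<otimes> B) $ i $ j"
  using max_mult_le_iff[of A B i j] by blast

lemma max_mult_attained: obtains k where "(A \<otimes> B) $ i $ j = A $ i $ k * B $ k $ j"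
proof -
  have "(A \<otimes> B) $ i $ j \<in> range (\<lambda>k. A $ i $ k * B $ k $ j)"
    by (simp add: max_mult_def)
  then show thesis using that by blast
qed

lemma max_mult_vec_le_iff: "(A \<otimes>v x) $ i \<le> c \<longleftrightarrow> (\<forall>k. A $ i $ k * x $ k \<le> c)"
  by (auto simp: max_mult_vec_def)

lemma max_mult_vec_upper: "A $ i $ k * x $ k \<le> (A \<otimes>v x) $ i"
  using max_mult_vec_le_iff[of A x i] by blast

lemma max_mult_vec_attained: obtains k where "(A \<otimes>v x) $ i = A $ i $ k * x $ k"
proof -
  have "(A \<otimes>v x) $ i \<in> range (\<lambda>k. A $ i $ k * x $ k)"
    by (simp add: max_mult_vec_def)
  then show thesis using that by blast
qed

lemma max_mult_vec_le: "A \<otimes>v x \<le> y \<longleftrightarrow> (\<forall>i j. A $ i $ j * x $ j \<le> y $ i)"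
  by (simp add: less_eq_vec_def max_mult_vec_le_iff)

lemma max_dot_le_iff: "x \<odot> y \<le> c \<longleftrightarrow> (\<forall>k. x $ k * y $ k \<le> c)"
  by (auto simp: max_dot_def)

lemma max_norm_le_iff: "max_norm x \<le> c \<longleftrightarrow> (\<forall>k. x $ k \<le> c)"
  by (auto simp: max_norm_def)

lemma max_norm_upper: "x $ k \<le> max_norm x"
  using max_norm_le_iff by blast

lemma max_norm_attained: obtains k where "max_norm x = x $ k"
proof -
  have "max_norm x \<in> range (($) x)"
    unfolding max_norm_def by (rule Max_in; simp)
  then show thesis using that by blast
qed

lemma one_max_dot: "1 \<odot> x = max_norm x"
  by (simp add: max_dot_def max_norm_def)

lemma max_dot_one: "x \<odot> 1 = max_norm x"
  by (simp add: max_dot_def max_norm_def)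

lemma max_norm_scaleR:
  assumes "0 \<le> c" shows "max_norm (c *\<^sub>R x) = c * max_norm x"
proof (rule antisym)
  show "max_norm (c *\<^sub>R x) \<le> c * max_norm x"
    using assms by (simp add: max_norm_le_iff mult_left_mono max_norm_upper)
  obtain k where "max_norm x = x $ k" by (rule max_norm_attained)
  then show "c * max_norm x \<le> max_norm (c *\<^sub>R x)" using max_norm_upper[of "c *\<^sub>R x" k] by simp
qed

lemma conj_vec_scaleR: "conj_vec (c *\<^sub>R x) = inverse c *\<^sub>R conj_vec x"
  by (simp add: conj_vec_def vec_eq_iff)

lemma mat_nonneg_iff: "0 \<le> (A :: real^'n^'m) \<longleftrightarrow> (\<forall>i j. 0 \<le> A $ i $ j)"
  by (simp add: less_eq_vec_def)

lemma mat_nonnegD: "0 \<le> (A :: real^'n^'m) \<Longrightarrow> 0 \<le> A $ i $ j"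
  by (simp add: mat_nonneg_iff)

lemma mat_le_iff: "(A :: real^'n^'m) \<le> B \<longleftrightarrow> (\<forall>i j. A $ i $ j \<le> B $ i $ j)"
  by (simp add: less_eq_vec_def)

lemma max_mult_nonneg:
  assumes "0 \<le> A" "0 \<le> B" shows "0 \<le> A \<otimes> B"
  unfolding mat_nonneg_iff
proof (intro allI)
  fix i j
  obtain k where "(A \<otimes> B) $ i $ j = A $ i $ k * B $ k $ j" by (rule max_mult_attained)
  then show "0 \<le> (A \<otimes> B) $ i $ j" using assms by (simp add: mat_nonnegD)
qed

lemma mat_one_nonneg: "0 \<le> (mat 1 :: real^'n^'n)"
  by (simp add: mat_nonneg_iff mat_def)

text \<open>An index attaining the inner product bounds each term of one side by a term of the
  other; nonnegative factors preserve such bounds.\<close>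

lemma max_mult_assoc:
  assumes "0 \<le> A" "0 \<le> B" "0 \<le> C" shows "(A \<otimes> B) \<otimes> C = A \<otimes> (B \<otimes> C)"
proof -
  have "(A \<otimes> B) $ i $ k * C $ k $ j \<le> (A \<otimes> (B \<otimes> C)) $ i $ j" for i j k
  proof -
    obtain l where "(A \<otimes> B) $ i $ k = A $ i $ l * B $ l $ k" by (rule max_mult_attained)
    then have "(A \<otimes> B) $ i $ k * C $ k $ j = A $ i $ l * (B $ l $ k * C $ k $ j)" by simp
    also have "\<dots> \<le> A $ i $ l * (B \<otimes> C) $ l $ j"
      by (intro mult_left_mono max_mult_upper mat_nonnegD assms)
    finally show ?thesis using max_mult_upper order_trans by blast
  qed
  moreover have "A $ i $ k * (B \<otimes> C) $ k $ j \<le> ((A \<otimes> B) \<otimes> C) $ i $ j" for i j k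
  proof -
    obtain l where "(B \<otimes> C) $ k $ j = B $ k $ l * C $ l $ j" by (rule max_mult_attained)
    then have "A $ i $ k * (B \<otimes> C) $ k $ j = (A $ i $ k * B $ k $ l) * C $ l $ j" by simp
    also have "\<dots> \<le> (A \<otimes> B) $ i $ l * C $ l $ j"
      by (intro mult_right_mono max_mult_upper mat_nonnegD assms)
    finally show ?thesis using max_mult_upper order_trans by blast
  qed
  ultimately show ?thesis by (intro order_antisym) (simp_all add: mat_le_iff max_mult_le_iff)
qed

lemma mat_one_max_mult: assumes "0 \<le> A" shows "mat 1 \<otimes> A = A"
proof (rule order_antisym)
  show "mat 1 \<otimes> A \<le> A"
    using assms by (auto simp: mat_le_iff max_mult_le_iff mat_def mat_nonneg_iff)
  show "A \<le> mat 1 \<otimes> A"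
    unfolding mat_le_iff
  proof (intro allI)
    fix i j
    show "A $ i $ j \<le> (mat 1 \<otimes> A) $ i $ j"
      using max_mult_upper[of "mat 1" i i A j] by (simp add: mat_def)
  qed
qed

lemma max_mult_mat_one: assumes "0 \<le> A" shows "A \<otimes> mat 1 = A"
proof (rule order_antisym)
  show "A \<otimes> mat 1 \<le> A"
    using assms by (auto simp: mat_le_iff max_mult_le_iff mat_def mat_nonneg_iff)
  show "A \<le> A \<otimes> mat 1"
    unfolding mat_le_iff
  proof (intro allI)
    fix i j
    show "A $ i $ j \<le> (A \<otimes> mat 1) $ i $ j"
      using max_mult_upper[of A i j "mat 1" j] by (simp add: mat_def)
  qed
qed

lemma max_pow_nonneg: "0 \<le> A \<Longrightarrow> 0 \<le> max_pow A p"
  by (induction p) (simp_all add: mat_one_nonneg max_mult_nonneg)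

lemma max_pow_add:
  assumes "0 \<le> A" shows "max_pow A (p + q) = max_pow A p \<otimes> max_pow A q"
  by (induction p) (simp_all add: assms mat_one_max_mult max_mult_assoc max_pow_nonneg)

lemma max_pow_one: "0 \<le> A \<Longrightarrow> max_pow A (Suc 0) = A"
  by (simp add: max_mult_mat_one)

lemma max_pow_mult_upper:
  assumes "0 \<le> A"
  shows "max_pow A p $ i $ k * max_pow A q $ k $ j \<le> max_pow A (p + q) $ i $ j"
  by (simp add: max_pow_add[OF assms] max_mult_upper)

subsection \<open>Powers, walks and the Kleene star\<close>

lemma max_tr_le_iff: "max_tr A \<le> c \<longleftrightarrow> (\<forall>k. A $ k $ k \<le> c)"
  by (auto simp: max_tr_def)

lemma max_tr_upper: "A $ k $ k \<le> max_tr A"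
  using max_tr_le_iff by blast

lemma max_Tr_le_iff:
  fixes A :: "real^'n^'n"
  shows "max_Tr A \<le> c \<longleftrightarrow> (\<forall>p\<in>{1..CARD('n)}. \<forall>k. max_pow A p $ k $ k \<le> c)"
proof -
  have "{1..CARD('n)} \<noteq> {}" by (simp add: Suc_le_eq)
  then show ?thesis by (simp add: max_Tr_def max_tr_le_iff)
qed

text \<open>A walk is a vertex sequence \<open>w\<close>, and its weight is the product of its
  edges. Together with \<open>max_pow_walk\<close> this makes every nonzero entry of a power the
  largest weight of a walk of that length.\<close>

lemma prod_walk_le_max_pow:
  assumes A: "0 \<le> A" and "s \<le> t"
  shows "(\<Prod>r=s..<t. A $ w r $ w (Suc r)) \<le> max_pow A (t - s) $ w s $ w t"
  using \<open>s \<le> t\<close>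
proof (induction rule: inc_induct)
  case base
  then show ?case by (simp add: mat_def)
next
  case (step s)
  have "(\<Prod>r=s..<t. A $ w r $ w (Suc r)) = A $ w s $ w (Suc s) * (\<Prod>r=Suc s..<t. A $ w r $ w (Suc r))"
    using step.hyps by (simp add: prod.atLeast_Suc_lessThan)
  also have "\<dots> \<le> A $ w s $ w (Suc s) * max_pow A (t - Suc s) $ w (Suc s) $ w t"
    by (intro mult_left_mono step.IH mat_nonnegD A)
  also have "\<dots> \<le> max_pow A (Suc (t - Suc s)) $ w s $ w t"
    by (simp add: max_mult_upper)
  finally show ?case using step.hyps by (simp add: Suc_diff_Suc)
qed

text \<open>Following indices that attain the maxima traces an optimal walk. A zero entry is
  excluded because no walk of length 0 joins distinct vertices.\<close>

lemma max_pow_walk: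
  assumes "max_pow A p $ i $ j \<noteq> 0"
  shows "\<exists>w. w 0 = i \<and> w p = j \<and> max_pow A p $ i $ j = (\<Prod>r=0..<p. A $ w r $ w (Suc r))"
  using assms
proof (induction p arbitrary: i)
  case 0
  then have "i = j" by (auto simp: mat_def split: if_splits)
  then show ?case by (intro exI[of _ "\<lambda>_. i"]) (simp add: mat_def)
next
  case (Suc p)
  obtain l where l: "max_pow A (Suc p) $ i $ j = A $ i $ l * max_pow A p $ l $ j"
    using max_mult_attained by (metis max_pow.simps(2))
  then obtain w where w: "w 0 = l" "w p = j"
    "max_pow A p $ l $ j = (\<Prod>r=0..<p. A $ w r $ w (Suc r))"
    using Suc by force
  \<comment> \<open>\<open>case_nat i w\<close> prepends the vertex \<open>i\<close> to the walk
    \<open>w\<close>.\<close>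
  then show ?case using l
    by (intro exI[of _ "case_nat i w"]) (simp add: prod.atLeast0_lessThan_Suc_shift del: max_pow.simps prod.op_ivl_Suc)
qed

text \<open>A walk of length \<open>CARD('n)\<close> visits a vertex twice, and deleting the closed walk in
  between, whose weight is at most 1, cannot decrease the weight.\<close>

lemma max_pow_card_le:
  fixes A :: "real^'n^'n"
  assumes A: "0 \<le> A" and Tr: "max_Tr A \<le> 1"
  shows "\<exists>p<CARD('n). max_pow A CARD('n) $ i $ j \<le> max_pow A p $ i $ j"
proof (cases "max_pow A CARD('n) $ i $ j = 0")
  case True
  then show ?thesis using max_pow_nonneg[OF A] by (intro exI[of _ 0]) (simp add: mat_def)
next
  case False
  let ?n = "CARD('n)"
  let ?P = "\<lambda>w s t. \<Prod>r=s..<t. A $ w r $ w (Suc r)"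
  obtain w where w: "w 0 = i" "w ?n = j" "max_pow A ?n $ i $ j = ?P w 0 ?n"
    using max_pow_walk[OF False] by blast
  have "\<not> inj_on w {0..?n}"
  proof
    assume "inj_on w {0..?n}"
    then have "card {0..?n} \<le> ?n" by (intro card_inj_on_le) auto
    then show False by simp
  qed
  then obtain s t where st: "s < t" "t \<le> ?n" "w s = w t"
    unfolding inj_on_def by (metis atLeastAtMost_iff linorder_neqE_nat)
  have nonneg: "0 \<le> ?P w a b" for a b by (intro prod_nonneg ballI mat_nonnegD A)
  have "?P w 0 ?n = ?P w 0 s * ?P w s t * ?P w t ?n"
    using st by (simp add: prod.atLeastLessThan_concat)
  also have "\<dots> \<le> ?P w 0 s * 1 * ?P w t ?n"
  proof (intro mult_right_mono mult_left_mono nonneg)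
    have "?P w s t \<le> max_pow A (t - s) $ w s $ w t"
      using prod_walk_le_max_pow[OF A, of s t w] st by simp
    also have "\<dots> \<le> 1"
      using Tr[unfolded max_Tr_le_iff, rule_format, of "t - s" "w t"] st
        le_trans[OF diff_le_self st(2)] by (simp add: Suc_le_eq)
    finally show "?P w s t \<le> 1" .
  qed
  also have "\<dots> \<le> max_pow A s $ i $ w s * max_pow A (?n - t) $ w t $ j"
    using prod_walk_le_max_pow[OF A, of 0 s w] prod_walk_le_max_pow[OF A, of t ?n w] st w nonneg
    by (simp add: mult_mono' )
  also have "\<dots> \<le> max_pow A (s + (?n - t)) $ i $ j"
    using max_pow_mult_upper[OF A] st(3) by metis
  finally show ?thesis using st w(3) by (intro exI[of _ "s + (?n - t)"]) auto
qed

section \<open>The Kleene star and its subsolutions\<close>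

lemma kleene_star_le_iff:
  fixes A :: "real^'n^'n"
  shows "kleene_star A $ i $ j \<le> c \<longleftrightarrow> (\<forall>p<CARD('n). max_pow A p $ i $ j \<le> c)"
proof -
  have "Suc (CARD('n) - 1) = CARD('n)" by simp
  then have "{0..CARD('n) - 1} = {..<CARD('n)}"
    by (metis atLeast0AtMost lessThan_Suc_atMost)
  then have "kleene_star A $ i $ j = (MAX p\<in>{..<CARD('n)}. max_pow A p $ i $ j)"
    by (simp only: kleene_star_def max_sum_def vec_lambda_beta)
  then show ?thesis by (simp only:) (subst Max_le_iff; auto simp: lessThan_empty_iff)
qed

lemma kleene_star_attained:
  fixes A :: "real^'n^'n"
  obtains p where "p < CARD('n)" "kleene_star A $ i $ j = max_pow A p $ i $ j"
proof -
  have "kleene_star A $ i $ j \<in> (\<lambda>p. max_pow A p $ i $ j) ` {0..CARD('n) - 1}"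
    by (simp add: kleene_star_def max_sum_def)
  then obtain p where "p \<le> CARD('n) - 1" "kleene_star A $ i $ j = max_pow A p $ i $ j" by auto
  moreover have "0 < CARD('n)" by simp
  ultimately show thesis using that by (metis Suc_pred' less_Suc_eq_le)
qed

text \<open>The exponent \<open>CARD('n)\<close> exceeds the range in the definition of the star.
  Admitting it lets one further factor \<open>A\<close> be absorbed, and covers \<open>A\<close>
  itself in dimension 1, where the star is only \<open>mat 1\<close>.\<close>

lemma max_pow_le_kleene_star:
  fixes A :: "real^'n^'n"
  assumes A: "0 \<le> A" and Tr: "max_Tr A \<le> 1" and p: "p \<le> CARD('n)"
  shows "max_pow A p $ i $ j \<le> kleene_star A $ i $ j"
proof -
  have *: "q < CARD('n) \<Longrightarrow> max_pow A q $ i $ j \<le> kleene_star A $ i $ j" for q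
    using kleene_star_le_iff[of A i j] by blast
  obtain q where "q < CARD('n)" "max_pow A p $ i $ j \<le> max_pow A q $ i $ j"
  proof (cases "p = CARD('n)")
    case True
    then show ?thesis using max_pow_card_le[OF A Tr, of i j] that by (elim exE conjE) simp
  next
    case False
    then show ?thesis using p by (intro that[of p]) simp_all
  qed
  then show ?thesis using *[of q] by linarith
qed

lemma le_kleene_star:
  fixes A :: "real^'n^'n"
  assumes "0 \<le> A" "max_Tr A \<le> 1"
  shows "A $ i $ j \<le> kleene_star A $ i $ j"
  using max_pow_le_kleene_star[OF assms, of "Suc 0" i j] max_pow_one[OF assms(1)]
  by (simp add: Suc_le_eq)

lemma kleene_star_diag:
  fixes A :: "real^'n^'n"
  assumes A: "0 \<le> A" and Tr: "max_Tr A \<le> 1"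
  shows "kleene_star A $ i $ i = 1"
proof (rule antisym)
  have "max_pow A p $ i $ i \<le> 1" if "p < CARD('n)" for p
    using Tr[unfolded max_Tr_le_iff, rule_format, of p i] that by (cases p) (simp_all add: mat_def)
  then show "kleene_star A $ i $ i \<le> 1" by (simp add: kleene_star_le_iff)
  show "1 \<le> kleene_star A $ i $ i"
    using max_pow_le_kleene_star[OF A Tr, of 0 i i] by (simp add: mat_def)
qed

text \<open>The star entry is attained at an exponent below the dimension, so one more factor raises
  it to at most the dimension, which \<open>max_pow_le_kleene_star\<close> still covers.\<close>

lemma kleene_star_mult_upper:
  assumes "0 \<le> A" "max_Tr A \<le> 1"
  shows "A $ i $ k * kleene_star A $ k $ j \<le> kleene_star A $ i $ j"
    and "kleene_star A $ i $ k * A $ k $ j \<le> kleene_star A $ i $ j"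
proof -
  obtain p where p: "p < CARD('a)" "kleene_star A $ k $ j = max_pow A p $ k $ j"
    by (rule kleene_star_attained)
  have "A $ i $ k * kleene_star A $ k $ j \<le> max_pow A (Suc p) $ i $ j"
    by (simp add: p max_mult_upper)
  also have "\<dots> \<le> kleene_star A $ i $ j"
    using p by (intro max_pow_le_kleene_star assms) simp
  finally show "A $ i $ k * kleene_star A $ k $ j \<le> kleene_star A $ i $ j" .
next
  obtain p where p: "p < CARD('a)" "kleene_star A $ i $ k = max_pow A p $ i $ k"
    by (rule kleene_star_attained)
  have "kleene_star A $ i $ k * A $ k $ j \<le> max_pow A (p + Suc 0) $ i $ j"
    using max_pow_mult_upper[OF assms(1), of p i k "Suc 0" j] max_pow_one[OF assms(1)] p by simp
  also have "\<dots> \<le> kleene_star A $ i $ j"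
    using p by (intro max_pow_le_kleene_star assms) simp
  finally show "kleene_star A $ i $ k * A $ k $ j \<le> kleene_star A $ i $ j" .
qed


lemma max_pow_subsolution:
  assumes "0 \<le> A" "0 \<le> x" and sub: "\<And>i j. A $ i $ j * x $ j \<le> x $ i"
  shows "max_pow A p $ i $ j * x $ j \<le> x $ i"
proof (induction p arbitrary: i)
  case 0
  then show ?case using \<open>0 \<le> x\<close> by (simp add: mat_def less_eq_vec_def)
next
  case (Suc p)
  obtain l where l: "max_pow A (Suc p) $ i $ j = A $ i $ l * max_pow A p $ l $ j"
    using max_mult_attained by (metis max_pow.simps(2))
  then have "max_pow A (Suc p) $ i $ j * x $ j = A $ i $ l * (max_pow A p $ l $ j * x $ j)" 
    by simp
  also have "\<dots> \<le> A $ i $ l * x $ l"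
    by (intro mult_left_mono Suc.IH mat_nonnegD assms)
  also have "\<dots> \<le> x $ i" by (rule sub)
  finally show ?case .
qed

lemma kleene_star_subsolution:
  assumes "0 \<le> A" "0 \<le> x" "\<And>i j. A $ i $ j * x $ j \<le> x $ i"
  shows "kleene_star A $ i $ j * x $ j \<le> x $ i"
  using max_pow_subsolution[OF assms] by (metis kleene_star_attained)

lemma subsolution_iff_kleene_star:
  assumes "0 \<le> A" "max_Tr A \<le> 1" "0 \<le> x"
  shows "(\<forall>i j. A $ i $ j * x $ j \<le> x $ i) \<longleftrightarrow> (\<forall>i j. kleene_star A $ i $ j * x $ j \<le> x $ i)"
proof
  assume "\<forall>i j. A $ i $ j * x $ j \<le> x $ i"
  then show "\<forall>i j. kleene_star A $ i $ j * x $ j \<le> x $ i"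
    using kleene_star_subsolution assms by blast
next
  assume *: "\<forall>i j. kleene_star A $ i $ j * x $ j \<le> x $ i"
  show "\<forall>i j. A $ i $ j * x $ j \<le> x $ i"
    using le_kleene_star[OF assms(1,2)] * assms(3) by (metis less_eq_vec_def mult_right_mono order_trans zero_index)
qed

subsection \<open>Words\<close>

lemma max_word_Nil: "max_word A B [] = mat 1"
  by (simp add: max_word_def)

lemma max_word_Cons: "max_word A B (q # is) = A \<otimes> max_pow B q \<otimes> max_word A B is"
  by (simp add: max_word_def)

lemma max_word_nonneg: "0 \<le> A \<Longrightarrow> 0 \<le> B \<Longrightarrow> 0 \<le> max_word A B is"
  by (induction "is")
    (simp_all add: max_word_Nil max_word_Cons mat_one_nonneg max_mult_nonneg max_pow_nonneg)

text \<open>The trailing power is absorbed by the last exponent, so the word must contain at least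
  one block, whence the form \<open>is @ [r]\<close>.\<close>

lemma max_word_snoc_mult_max_pow:
  assumes "0 \<le> A" "0 \<le> B"
  shows "max_word A B (is @ [r]) \<otimes> max_pow B q = max_word A B (is @ [r + q])"
  by (induction "is") (simp_all add: assms max_word_Nil max_word_Cons max_mult_assoc max_mult_nonneg
      max_word_nonneg max_pow_nonneg max_pow_add max_mult_mat_one mat_one_nonneg mat_one_max_mult)

text \<open>Along an optimal walk each edge comes from the scaled \<open>A\<close> or from
  \<open>B\<close>. Grouping the edges of \<open>B\<close> into runs gives the exponents:
  \<open>q\<close> counts those before the first edge of \<open>A\<close>, the list those after each
  edge of \<open>A\<close>.\<close>

lemma max_pow_max_add_le_word:
  fixes A B :: "real^'n^'n"
  assumes A: "0 \<le> A" and B: "0 \<le> B" and c: "0 \<le> c"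
  shows "\<exists>q is. q + sum_list is + length is = p \<and>
    max_pow (c *\<^sub>R A \<oplus> B) p $ i $ j \<le> c ^ length is * (max_pow B q \<otimes> max_word A B is) $ i $ j"
proof (induction p arbitrary: i)
  case 0
  show ?case
    by (intro exI[of _ 0] exI[of _ "[]"]) (simp add: max_word_Nil mat_one_max_mult mat_one_nonneg)
next
  case (Suc p)
  let ?M = "c *\<^sub>R A \<oplus> B"
  obtain l where l: "max_pow ?M (Suc p) $ i $ j = ?M $ i $ l * max_pow ?M p $ l $ j"
    using max_mult_attained by (metis max_pow.simps(2))
  obtain q "is" where *: "q + sum_list is + length is = p"
    "max_pow ?M p $ l $ j \<le> c ^ length is * (max_pow B q \<otimes> max_word A B is) $ l $ j"
    using Suc.IH by blast
  let ?W = "max_pow B q \<otimes> max_word A B is"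
  have W: "0 \<le> ?W" by (intro max_mult_nonneg max_pow_nonneg max_word_nonneg A B)
  have M: "?M $ i $ l = max (c * A $ i $ l) (B $ i $ l)" by (simp add: max_add_def)
  then have "0 \<le> ?M $ i $ l" using mat_nonnegD[OF B, of i l] by simp
  then have le: "max_pow ?M (Suc p) $ i $ j \<le> ?M $ i $ l * (c ^ length is * ?W $ l $ j)"
    unfolding l by (intro mult_left_mono *)
  show ?case
  \<comment> \<open>The larger term decides the type of the first edge. An edge of \<open>B\<close>
    lengthens the leading run; an edge of \<open>A\<close> turns that run into the first exponent of
    the list and leaves the leading run empty.\<close>
  proof (cases "c * A $ i $ l \<le> B $ i $ l")
    case True
    then have "?M $ i $ l * (c ^ length is * ?W $ l $ j) = c ^ length is * (B $ i $ l * ?W $ l $ j)"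
      by (simp add: M)
    also have "\<dots> \<le> c ^ length is * (B \<otimes> ?W) $ i $ j"
      using c by (intro mult_left_mono max_mult_upper) simp
    also have "B \<otimes> ?W = max_pow B (Suc q) \<otimes> max_word A B is"
      by (simp add: max_mult_assoc B A max_pow_nonneg max_word_nonneg)
    finally show ?thesis using le * by (intro exI[of _ "Suc q"] exI[of _ "is"]) simp
  next
    case False
    then have "?M $ i $ l * (c ^ length is * ?W $ l $ j) = c ^ length (q # is) * (A $ i $ l * ?W $ l $ j)"
      by (simp add: M)
    also have "\<dots> \<le> c ^ length (q # is) * (A \<otimes> ?W) $ i $ j"
      using c by (intro mult_left_mono max_mult_upper) simp
    also have "A \<otimes> ?W = max_pow B 0 \<otimes> max_word A B (q # is)"
      by (simp add: max_word_Cons max_mult_assoc B A max_pow_nonneg max_word_nonneg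
          mat_one_max_mult max_mult_nonneg)
    finally show ?thesis using le * by (intro exI[of _ 0] exI[of _ "q # is"]) simp
  qed
qed

section \<open>The value \<open>theta\<close> as a bound and as a scaling factor\<close>

lemma finite_exponents: "finite {is :: nat list. length is = k \<and> sum_list is \<le> s}"
proof (rule finite_subset)
  show "{is. length is = k \<and> sum_list is \<le> s} \<subseteq> {is. set is \<subseteq> {..s} \<and> length is = k}"
    using member_le_sum_list by fastforce
qed (simp add: finite_lists_length_eq)

text \<open>The nested maxima merge into one condition on exponent lists;
  \<open>length is \<le> CARD('n)\<close> is implicit in the bound on the total length.\<close>

lemma theta_le_iff:
  fixes A B :: "real^'n^'n"
  shows "theta A B \<le> c \<longleftrightarrow> (\<forall>is. 1 \<le> length is \<longrightarrow> length is + sum_list is \<le> CARD('n) \<longrightarrow>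
    root (length is) (max_tr (max_word A B is)) \<le> c)"
proof -
  have "{is. length is = k \<and> sum_list is \<le> CARD('n) - k} \<noteq> ({} :: nat list set)" for k
    by (auto intro: exI[of _ "replicate k 0"] simp: sum_list_replicate)
  moreover have "{1..CARD('n)} \<noteq> {}" by (simp add: Suc_le_eq)
  ultimately have "theta A B \<le> c \<longleftrightarrow> (\<forall>k\<in>{1..CARD('n)}.
    \<forall>is\<in>{is. length is = k \<and> sum_list is \<le> CARD('n) - k}. root k (max_tr (max_word A B is)) \<le> c)"
    by (simp add: theta_def finite_exponents)
  then show ?thesis by fastforce
qed

lemma max_word_diag_le_theta:
  fixes A B :: "real^'n^'n"
  assumes A: "0 \<le> A" and B: "0 \<le> B" and "1 \<le> length is" "length is + sum_list is \<le> CARD('n)"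
  shows "max_word A B is $ i $ i \<le> theta A B ^ length is"
proof -
  let ?k = "length is" and ?t = "max_tr (max_word A B is)"
  have t: "max_word A B is $ i $ i \<le> ?t" by (rule max_tr_upper)
  moreover have "0 \<le> max_word A B is $ i $ i" by (intro mat_nonnegD max_word_nonneg A B)
  ultimately have "0 \<le> ?t" by linarith
  have "root ?k ?t \<le> theta A B" using theta_le_iff assms by blast
  then have "root ?k ?t ^ ?k \<le> theta A B ^ ?k"
    using \<open>0 \<le> ?t\<close> by (intro power_mono real_root_ge_zero)
  also have "root ?k ?t ^ ?k = ?t"
    using \<open>0 \<le> ?t\<close> assms(3) by (intro real_root_pow_pos2) linarith
  finally show ?thesis using t by linarith
qed

text \<open>Rotating a closed walk so that it starts with an edge of \<open>A\<close> turns its weight into a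
  diagonal entry of a word.\<close>

lemma max_Tr_max_add_le_one:
  fixes A B :: "real^'n^'n"
  assumes A: "0 \<le> A" and B: "0 \<le> B" and Tr: "max_Tr B \<le> 1" and pos: "0 < theta A B"
  shows "max_Tr (inverse (theta A B) *\<^sub>R A \<oplus> B) \<le> 1"
  unfolding max_Tr_le_iff
proof (intro ballI allI)
  fix p i assume p: "p \<in> {1..CARD('n)}"
  let ?c = "inverse (theta A B)"
  obtain q "is" where *: "q + sum_list is + length is = p"
    "max_pow (?c *\<^sub>R A \<oplus> B) p $ i $ i \<le> ?c ^ length is * (max_pow B q \<otimes> max_word A B is) $ i $ i"
    using max_pow_max_add_le_word[OF A B, of ?c p i i] pos by auto
  show "max_pow (?c *\<^sub>R A \<oplus> B) p $ i $ i \<le> 1"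
  proof (cases "is" rule: rev_cases)
    \<comment> \<open>The closed walk uses edges of \<open>B\<close> only, so
      \<open>max_Tr B \<le> 1\<close> bounds it.\<close>
    case Nil
    then show ?thesis using * Tr p
      by (auto simp: max_word_Nil max_mult_mat_one max_pow_nonneg B max_Tr_le_iff intro: order_trans)
  next
    case (snoc js r)
    \<comment> \<open>Moving the leading run of \<open>q\<close> edges to the end extends the last
      run. The total length is still \<open>p\<close>, hence at most \<open>CARD('n)\<close>, as the
      bound by \<open>theta\<close> requires.\<close>
    let ?js = "js @ [r + q]"
    obtain l where l: "(max_pow B q \<otimes> max_word A B is) $ i $ i = max_pow B q $ i $ l * max_word A B is $ l $ i"
      by (rule max_mult_attained)
    also have "\<dots> \<le> (max_word A B is \<otimes> max_pow B q) $ l $ l"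
      using max_mult_upper by (metis mult.commute)
    also have "\<dots> = max_word A B ?js $ l $ l"
      by (simp add: snoc max_word_snoc_mult_max_pow A B)
    also have "\<dots> \<le> theta A B ^ length ?js"
      using snoc * p by (intro max_word_diag_le_theta A B) auto
    finally have "?c ^ length is * (max_pow B q \<otimes> max_word A B is) $ i $ i \<le> ?c ^ length is * theta A B ^ length is"
      using pos by (intro mult_left_mono) (simp_all add: snoc)
    also have "\<dots> = 1" using pos by (simp flip: power_mult_distrib)
    finally show ?thesis using * by linarith
  qed
qed

text \<open>Each block costs one factor \<open>\<mu>\<close> for its letter \<open>A\<close>, while
  its power of \<open>B\<close> costs nothing.\<close>

lemma max_word_subsolution:
  assumes A: "0 \<le> A" and B: "0 \<le> B" and x: "0 \<le> x" and "0 \<le> \<mu>"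
    and subA: "\<And>i j. A $ i $ j * x $ j \<le> \<mu> * x $ i"
    and subB: "\<And>i j. B $ i $ j * x $ j \<le> x $ i"
  shows "max_word A B is $ i $ j * x $ j \<le> \<mu> ^ length is * x $ i"
proof (induction "is" arbitrary: i)
  case Nil
  then show ?case using x by (simp add: max_word_Nil mat_def less_eq_vec_def)
next
  case (Cons q "is")
  obtain l where l: "max_word A B (q # is) $ i $ j = (A \<otimes> max_pow B q) $ i $ l * max_word A B is $ l $ j"
    unfolding max_word_Cons by (rule max_mult_attained)
  obtain h where h: "(A \<otimes> max_pow B q) $ i $ l = A $ i $ h * max_pow B q $ h $ l"
    by (rule max_mult_attained)
  have "max_word A B (q # is) $ i $ j * x $ j = A $ i $ h * (max_pow B q $ h $ l * (max_word A B is $ l $ j * x $ j))"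
    by (simp add: l h)
  also have "\<dots> \<le> A $ i $ h * (max_pow B q $ h $ l * (\<mu> ^ length is * x $ l))"
    by (intro mult_left_mono Cons.IH mat_nonnegD A max_pow_nonneg B)
  also have "\<dots> = \<mu> ^ length is * (A $ i $ h * (max_pow B q $ h $ l * x $ l))" by simp
  also have "\<dots> \<le> \<mu> ^ length is * (A $ i $ h * x $ h)"
    using \<open>0 \<le> \<mu>\<close> by (intro mult_left_mono max_pow_subsolution B x subB mat_nonnegD A) simp
  also have "\<dots> \<le> \<mu> ^ length is * (\<mu> * x $ i)"
    using \<open>0 \<le> \<mu>\<close> by (intro mult_left_mono subA) simp
  finally show ?case by (simp add: mult_ac)
qed

text \<open>On the diagonal, \<open>max_word_subsolution\<close> has the same positive factor
  \<open>x $ i\<close> on both sides; cancelling it and taking roots leaves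
  \<open>\<mu>\<close>.\<close>

lemma theta_le:
  assumes "0 \<le> A" "0 \<le> B" "\<And>i. 0 < x $ i" "0 \<le> \<mu>"
    and "\<And>i j. A $ i $ j * x $ j \<le> \<mu> * x $ i" "\<And>i j. B $ i $ j * x $ j \<le> x $ i"
  shows "theta A B \<le> \<mu>"
  unfolding theta_le_iff
proof (intro allI impI)
  fix "is" :: "nat list" assume k: "1 \<le> length is"
  have x: "0 \<le> x" using assms(3) by (simp add: less_eq_vec_def less_imp_le)
  have "max_word A B is $ i $ i \<le> \<mu> ^ length is" for i
    using max_word_subsolution[OF assms(1,2) x assms(4,5,6), of "is" i i] assms(3)[of i] by simp
  then have "max_tr (max_word A B is) \<le> \<mu> ^ length is" by (simp add: max_tr_le_iff)
  then have "root (length is) (max_tr (max_word A B is)) \<le> root (length is) (\<mu> ^ length is)"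
    using k by (intro real_root_le_mono) linarith+
  then show "root (length is) (max_tr (max_word A B is)) \<le> \<mu>"
    using real_root_power_cancel[of "length is" \<mu>] k \<open>0 \<le> \<mu>\<close> by linarith
qed


subsection \<open>Max-ordering solutions\<close>

text \<open>The common ground of the three claims: the solution set is shown to be such a cone, and
  its parametric form and extremal elements are derived from the entrywise inequalities.\<close>

definition star_cone :: "real^'n^'n \<Rightarrow> (real^'n) set" where
  "star_cone G = {x. (\<forall>i. 0 < x $ i) \<and> (\<forall>i j. G $ i $ j * x $ j \<le> x $ i)}"

lemma feasible_iff: "feasible B x \<longleftrightarrow> (\<forall>i. 0 < x $ i) \<and> (\<forall>i j. B $ i $ j * x $ j \<le> x $ i)"
  by (auto simp: feasible_def regular_def max_mult_vec_le) (auto simp: less_eq_vec_def less_le)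

lemma max_sum_mult_le_iff:
  fixes c d :: real
  assumes "finite S" "S \<noteq> {}" "0 < d"
  shows "max_sum F S $ i $ j * d \<le> c \<longleftrightarrow> (\<forall>l\<in>S. F l $ i $ j * d \<le> c)"
proof -
  have "max_sum F S $ i $ j * d \<le> c \<longleftrightarrow> max_sum F S $ i $ j \<le> c / d"
    using assms by (simp add: pos_le_divide_eq)
  also have "\<dots> \<longleftrightarrow> (\<forall>l\<in>S. F l $ i $ j \<le> c / d)"
    using assms by (simp add: max_sum_def)
  finally show ?thesis using assms by (simp add: pos_le_divide_eq)
qed

lemma objective_le_iff:
  assumes "\<And>i. 0 < x $ i"
  shows "conj_vec x \<odot> (A \<otimes>v x) \<le> \<mu> \<longleftrightarrow> (\<forall>i j. A $ i $ j * x $ j \<le> \<mu> * x $ i)"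
proof -
  have "conj_vec x $ i * (A \<otimes>v x) $ i \<le> \<mu> \<longleftrightarrow> (A \<otimes>v x) $ i \<le> \<mu> * x $ i" for i
    using assms[of i] by (simp add: conj_vec_def field_simps)
  then show ?thesis by (simp add: max_dot_le_iff max_mult_vec_le_iff)
qed

text \<open>Bounding all objectives by the same number amounts to bounding the one objective of the
  entrywise maximum of the matrices.\<close>

lemma max_objective_le_iff:
  fixes m :: nat
  assumes "m \<ge> 1" "\<And>i. 0 < x $ i"
  shows "(MAX l\<in>{1..m}. conj_vec x \<odot> (C l \<otimes>v x)) \<le> \<mu> \<longleftrightarrow>
    (\<forall>i j. max_sum C {1..m} $ i $ j * x $ j \<le> \<mu> * x $ i)"
proof -
  have "(MAX l\<in>{1..m}. conj_vec x \<odot> (C l \<otimes>v x)) \<le> \<mu> \<longleftrightarrow>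
      (\<forall>l\<in>{1..m}. \<forall>i j. C l $ i $ j * x $ j \<le> \<mu> * x $ i)"
  proof -
    have "(MAX l\<in>{1..m}. conj_vec x \<odot> (C l \<otimes>v x)) \<le> \<mu> \<longleftrightarrow>
        (\<forall>l\<in>{1..m}. conj_vec x \<odot> (C l \<otimes>v x) \<le> \<mu>)"
      using assms(1) by (subst Max_le_iff) auto
    then show ?thesis by (simp only: objective_le_iff[OF assms(2)])
  qed
  also have "\<dots> \<longleftrightarrow> (\<forall>i j. max_sum C {1..m} $ i $ j * x $ j \<le> \<mu> * x $ i)"
    using assms by (subst max_sum_mult_le_iff) auto
  finally show ?thesis .
qed

lemma theta_pos:
  fixes A B :: "real^'n^'n"
  assumes A: "0 \<le> A" and B: "0 \<le> B" and "0 < A $ i $ i"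
  shows "0 < theta A B"
proof -
  have "A $ i $ i \<le> theta A B"
    using max_word_diag_le_theta[OF A B, of "[0]" i] A
    by (simp add: max_word_Cons max_word_Nil max_mult_mat_one Suc_le_eq)
  then show ?thesis using assms(3) by linarith
qed

text \<open>The cone of the star consists of the feasible vectors with objective at most
  \<open>theta A B\<close>. These are the minimizers because that value is a lower bound on the
  feasible set and the cone is nonempty.\<close>

lemma max_ordering_solutions_eq:
  fixes C :: "nat \<Rightarrow> real^'n^'n" and B :: "real^'n^'n" and m :: nat
  defines "A \<equiv> max_sum C {1..m}"
  defines "B\<^sub>1 \<equiv> inverse (theta A B) *\<^sub>R A \<oplus> B"
  assumes "m \<ge> 1" and B: "0 \<le> B" and "max_Tr B \<le> 1" and A_pos: "\<And>i j. 0 < A $ i $ j"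
  shows "{x. max_ordering_solution m C B x} = star_cone (kleene_star B\<^sub>1)"
proof -
  let ?\<theta> = "theta A B" and ?G = "kleene_star B\<^sub>1"
  let ?f = "\<lambda>x. MAX l\<in>{1..m}. conj_vec x \<odot> (C l \<otimes>v x)"
  have A: "0 \<le> A" using A_pos by (simp add: mat_nonneg_iff less_imp_le)
  have \<theta>: "0 < ?\<theta>" using theta_pos[OF A B A_pos] .
  have B1: "B\<^sub>1 $ i $ j = max (inverse ?\<theta> * A $ i $ j) (B $ i $ j)" for i j
    by (simp add: B\<^sub>1_def max_add_def)
  have B1_pos: "0 < B\<^sub>1 $ i $ j" for i j using A_pos \<theta> by (simp add: B1 less_max_iff_disj)
  then have B1_nonneg: "0 \<le> B\<^sub>1" by (simp add: mat_nonneg_iff less_imp_le)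
  have Tr: "max_Tr B\<^sub>1 \<le> 1"
    unfolding B\<^sub>1_def using A B assms(5) \<theta> by (rule max_Tr_max_add_le_one)
  have f_le_iff: "?f x \<le> \<mu> \<longleftrightarrow> (\<forall>i j. A $ i $ j * x $ j \<le> \<mu> * x $ i)" if "\<forall>i. 0 < x $ i" for x \<mu>
    using max_objective_le_iff[of m x C \<mu>] that \<open>m \<ge> 1\<close> by (simp add: A_def)
  have theta_le_f: "?\<theta> \<le> ?f x" if x: "feasible B x" for x
  proof (rule theta_le[OF A B])
    show x_pos: "0 < x $ i" for i using x by (simp add: feasible_iff)
    show le: "A $ i $ j * x $ j \<le> ?f x * x $ i" for i j using f_le_iff[of x "?f x"] x_pos by blast
    \<comment> \<open>The sign of the objective is read off a diagonal entry,
      \<open>undefined\<close> being an arbitrary index.\<close>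
    have "0 < ?f x * x $ undefined"
      using le[of undefined undefined] A_pos x_pos by (metis less_le_trans mult_pos_pos)
    then show "0 \<le> ?f x" using x_pos by (metis less_imp_le zero_less_mult_pos2)
    show "B $ i $ j * x $ j \<le> x $ i" for i j using x by (simp add: feasible_iff)
  qed
  have cone: "x \<in> star_cone ?G \<longleftrightarrow> feasible B x \<and> ?f x \<le> ?\<theta>" for x
  proof (cases "\<forall>i. 0 < x $ i")
    case True
    \<comment> \<open>As the entries of \<open>B\<^sub>1\<close> are maxima, its inequality splits
      into feasibility and the objective bound.\<close>
    have "B\<^sub>1 $ i $ j * x $ j \<le> x $ i \<longleftrightarrow> B $ i $ j * x $ j \<le> x $ i \<and> A $ i $ j * x $ j \<le> ?\<theta> * x $ i" for i j
    proof -
      have "inverse ?\<theta> * A $ i $ j * x $ j \<le> x $ i \<longleftrightarrow> A $ i $ j * x $ j \<le> ?\<theta> * x $ i"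
        using \<theta> by (simp add: field_simps)
      moreover have "0 \<le> x $ j" using True by (simp add: less_imp_le)
      ultimately show ?thesis by (auto simp: B1 max_mult_distrib_right)
    qed
    moreover have "0 \<le> x" using True by (simp add: less_eq_vec_def less_imp_le)
    ultimately show ?thesis
      using True subsolution_iff_kleene_star[OF B1_nonneg Tr, of x] f_le_iff[of x ?\<theta>]
      by (auto simp: star_cone_def feasible_iff)
  next
    case False
    then show ?thesis by (simp only: star_cone_def feasible_iff mem_Collect_eq simp_thms)
  qed
  \<comment> \<open>Any column of the star shows that the cone is nonempty, so that the lower bound
    is attained.\<close>
  let ?x = "column undefined ?G"
  have "?x \<in> star_cone ?G"
  proof -
    have "0 < ?x $ i" for i
      using less_le_trans[OF B1_pos le_kleene_star[OF B1_nonneg Tr]] by (simp add: column_def)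
    moreover have "B\<^sub>1 $ i $ j * ?x $ j \<le> ?x $ i" for i j
      by (simp add: column_def kleene_star_mult_upper B1_nonneg Tr)
    ultimately show ?thesis
      using kleene_star_subsolution[OF B1_nonneg, of ?x]
      by (simp add: star_cone_def less_eq_vec_def less_imp_le)
  qed
  then have x: "feasible B ?x" "?f ?x \<le> ?\<theta>" using cone by blast+
  show ?thesis
  proof (intro set_eqI)
    fix x
    show "x \<in> {x. max_ordering_solution m C B x} \<longleftrightarrow> x \<in> star_cone ?G"
      unfolding cone max_ordering_solution_def is_arg_min_linorder mem_Collect_eq
      using theta_le_f x by (meson order_trans)
  qed
qed

subsection \<open>Best and worst differentiating solutions\<close>

text \<open>A least element of \<open>S\<close> lies below everything satisfying \<open>P\<close>.
  Conversely, by finiteness each element of \<open>S\<close> lies above a minimal element of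
  \<open>S\<close>, which is also minimal for \<open>P\<close>; if only one element is minimal for
  \<open>P\<close>, it is therefore least in \<open>S\<close>.\<close>

lemma minimal_given_byI:
  assumes fin: "finite S" and S: "\<And>s. s \<in> S \<Longrightarrow> P s" and below: "\<And>x. P x \<Longrightarrow> \<exists>s\<in>S. s \<le> x"
  shows "minimal_given_by P S"
proof -
  have "minimal_such P x \<longleftrightarrow> x = s" if s: "least_such (\<lambda>s. s \<in> S) s" for s x
  proof -
    have "s \<le> y" if "P y" for y using s below[OF that] unfolding least_such_def by (meson order_trans)
    moreover have "P s" using s S by (simp add: least_such_def)
    ultimately show ?thesis unfolding minimal_such_def by (metis order_antisym)
  qed
  moreover have "\<exists>s. least_such (\<lambda>s. s \<in> S) s" if "\<exists>!x. minimal_such P x"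
  proof -
    obtain x where x: "minimal_such P x" "\<And>y. minimal_such P y \<Longrightarrow> y = x" using \<open>\<exists>!x. minimal_such P x\<close> by blast
    have "x \<in> S" using x(1) below S unfolding minimal_such_def by metis
    moreover have "x \<le> y" if "y \<in> S" for y
    proof -
      obtain s where s: "s \<in> S" "s \<le> y" "\<And>b. b \<in> S \<Longrightarrow> b \<le> s \<Longrightarrow> s = b"
        using finite_has_minimal2[OF fin \<open>y \<in> S\<close>] by blast
      have "minimal_such P s"
        unfolding minimal_such_def using s S below by (metis order_antisym order_trans)
      then show ?thesis using x(2) s(2) by blast
    qed
    ultimately show ?thesis unfolding least_such_def by blast
  qed
  ultimately show ?thesis
    unfolding minimal_given_by_def using fin S below by (intro conjI) blast+
qed

text \<open>Isolates the properties of the star on which the parametric form and the extremal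
  solutions rest. With the unit diagonal, \<open>idem\<close> amounts to
  \<open>G \<otimes> G = G\<close>.\<close>

locale positive_star =
  fixes G :: "real^'n^'n"
  assumes pos: "0 < G $ i $ j"
    and diag: "G $ i $ i = 1"
    and idem: "G $ i $ k * G $ k $ j \<le> G $ i $ j"
begin

lemma star_cone_pos: "x \<in> star_cone G \<Longrightarrow> 0 < x $ i"
  by (simp add: star_cone_def)

lemma star_cone_le: "x \<in> star_cone G \<Longrightarrow> G $ i $ j * x $ j \<le> x $ i"
  by (simp add: star_cone_def)

text \<open>An element of the cone is fixed by \<open>G\<close>, hence serves as its own parameter;
  conversely, idempotence keeps every image in the cone.\<close>

lemma star_cone_eq_image: "star_cone G = {G \<otimes>v u |u. 0 \<le> u \<and> u \<noteq> 0}"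
proof (intro set_eqI iffI)
  fix x assume x: "x \<in> star_cone G"
  have "(G \<otimes>v x) $ i = x $ i" for i
  proof (rule antisym)
    show "(G \<otimes>v x) $ i \<le> x $ i" using x by (simp add: max_mult_vec_le_iff star_cone_le)
    show "x $ i \<le> (G \<otimes>v x) $ i" using max_mult_vec_upper[of G i i x] by (simp add: diag)
  qed
  then have "x = G \<otimes>v x" by (simp add: vec_eq_iff)
  moreover have "0 \<le> x" using star_cone_pos[OF x] by (simp add: less_eq_vec_def less_imp_le)
  moreover have "x \<noteq> 0" using star_cone_pos[OF x] by (metis less_irrefl zero_index)
  ultimately show "x \<in> {G \<otimes>v u |u. 0 \<le> u \<and> u \<noteq> 0}" by blast
next
  fix x assume "x \<in> {G \<otimes>v u |u. 0 \<le> u \<and> u \<noteq> 0}"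
  then obtain u where x: "x = G \<otimes>v u" and u: "0 \<le> u" "u \<noteq> 0" by blast
  obtain k where "u $ k \<noteq> 0" using u(2) by (auto simp: vec_eq_iff)
  then have "0 < u $ k" using u(1) by (simp add: less_eq_vec_def less_le)
  then have "0 < x $ i" for i
    unfolding x using max_mult_vec_upper[of G i k u] pos by (meson less_le_trans mult_pos_pos)
  moreover have "G $ i $ j * x $ j \<le> x $ i" for i j
  proof -
    obtain l where "x $ j = G $ j $ l * u $ l" unfolding x by (rule max_mult_vec_attained)
    then have "G $ i $ j * x $ j = (G $ i $ j * G $ j $ l) * u $ l" by simp
    also have "\<dots> \<le> G $ i $ l * u $ l"
      using u(1) by (intro mult_right_mono idem) (simp add: less_eq_vec_def)
    also have "\<dots> \<le> x $ i" unfolding x by (rule max_mult_vec_upper)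
    finally show ?thesis .
  qed
  ultimately show "x \<in> star_cone G" by (simp add: star_cone_def)
qed

lemma star_cone_scaleR: "x \<in> star_cone G \<Longrightarrow> 0 < c \<Longrightarrow> c *\<^sub>R x \<in> star_cone G"
  by (simp add: star_cone_def mult.left_commute)

lemma column_in_star_cone: "column j G \<in> star_cone G"
  by (simp add: star_cone_def column_def pos idem)

lemma one_le_max_norm_column: "1 \<le> max_norm (column j G)"
  using max_norm_upper[of "column j G" j] by (simp add: column_def diag)

text \<open>If a column \<open>x\<close> is largest in row \<open>j\<close>, then
  \<open>G $ i $ j * x $ j \<le> x $ i \<le> x $ j\<close>, so all entries of column
  \<open>j\<close> are at most 1.\<close>

lemma exists_column_max_norm_one: "\<exists>j. max_norm (column j G) = 1"
proof -
  let ?x = "column undefined G"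
  obtain j where j: "max_norm ?x = ?x $ j" by (rule max_norm_attained)
  have "column j G $ i \<le> 1" for i
  proof -
    have "G $ i $ j * ?x $ j \<le> ?x $ j"
      using star_cone_le[OF column_in_star_cone, of i j undefined] max_norm_upper[of ?x i] j
      by linarith
    then show ?thesis using pos[of j undefined] by (simp add: column_def)
  qed
  then have "max_norm (column j G) \<le> 1" by (simp add: max_norm_le_iff)
  then show ?thesis using one_le_max_norm_column by (metis order_antisym)
qed

text \<open>The vector is even the greatest among all normalized elements of the cone. Conjugation
  reverses the order, so it also minimizes the objective.\<close>

lemma greatest_worst_differentiating:
  "greatest_such (worst_differentiating (star_cone G)) (conj_vec (1 v\<otimes> G))"
proof -
  let ?w = "conj_vec (1 v\<otimes> G)" and ?M = "\<lambda>j. max_norm (column j G)"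
  have w: "?w $ j = inverse (?M j)" for j
    by (simp add: conj_vec_def vec_max_mult_def max_norm_def column_def)
  have M: "0 < ?M j" for j using one_le_max_norm_column by (rule less_le_trans[OF zero_less_one])
  have "G $ i $ j * ?w $ j \<le> ?w $ i" for i j
  proof -
    \<comment> \<open>In a row \<open>k\<close> where column \<open>i\<close> is largest,
      \<open>G $ k $ i * G $ i $ j \<le> G $ k $ j\<close>.\<close>
    have "max_norm (column i G) * G $ i $ j \<le> ?M j"
    proof -
      obtain k where "?M i = G $ k $ i" using max_norm_attained[of "column i G"] by (auto simp: column_def)
      then have "?M i * G $ i $ j \<le> column j G $ k" by (simp add: idem column_def)
      then show ?thesis using max_norm_upper order_trans by blast
    qed
    then show ?thesis using M[of i] M[of j] by (simp add: w field_simps)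
  qed
  then have w_cone: "?w \<in> star_cone G" using M by (simp add: star_cone_def w)
  have w_norm: "max_norm ?w = 1"
  proof (rule antisym)
    show "max_norm ?w \<le> 1"
      using one_le_max_norm_column by (simp add: max_norm_le_iff w inverse_le_1_iff)
    show "1 \<le> max_norm ?w"
      using exists_column_max_norm_one max_norm_upper[of ?w] w by (metis inverse_1)
  qed
  have le_w: "x \<le> ?w" if x: "x \<in> star_cone G" "max_norm x = 1" for x
    unfolding less_eq_vec_def
  proof
    fix j
    obtain i where "?M j = G $ i $ j" using max_norm_attained[of "column j G"] by (auto simp: column_def)
    then have "?M j * x $ j \<le> 1"
      using star_cone_le[OF x(1), of i j] max_norm_upper[of x i] x(2) by simp
    then show "x $ j \<le> ?w $ j" using M[of j] by (simp add: w field_simps)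
  qed
  have "max_norm (conj_vec ?w) \<le> max_norm (conj_vec x)"
    if x: "x \<in> star_cone G" "max_norm x = 1" for x
    unfolding max_norm_le_iff
  proof
    fix k
    have "conj_vec ?w $ k \<le> conj_vec x $ k"
      using le_w[OF x] star_cone_pos[OF x(1), of k] unfolding conj_vec_def[of ?w] conj_vec_def[of x]
      by (simp add: less_eq_vec_def le_imp_inverse_le)
    then show "conj_vec ?w $ k \<le> max_norm (conj_vec x)" using max_norm_upper order_trans by blast
  qed
  then show ?thesis
    using w_cone w_norm le_w
    by (simp add: greatest_such_def worst_differentiating_def is_arg_min_linorder one_max_dot max_dot_one)
qed

text \<open>If the largest entry \<open>1\<close> of \<open>x\<close> sits at \<open>k\<close>, then \<open>x\<close> dominates column \<open>k\<close>; when \<open>x\<close> is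
  best differentiating, all estimates are equalities and that column is already normalized.\<close>

lemma minimal_best_differentiating:
  defines "D \<equiv> \<lambda>j. max_norm (column j G) * max_norm (conj_vec (column j G))"
  shows "minimal_given_by (best_differentiating (star_cone G))
    {inverse (max_norm (column k G)) *\<^sub>R column k G |k. is_arg_max D (\<lambda>_. True) k}"
    (is "minimal_given_by _ ?S")
proof -
  let ?M = "\<lambda>j. max_norm (column j G)" and ?N = "\<lambda>j. max_norm (conj_vec (column j G))"
  let ?s = "\<lambda>k. inverse (?M k) *\<^sub>R column k G"
  have best_iff: "best_differentiating (star_cone G) x \<longleftrightarrow> x \<in> star_cone G \<and> max_norm x = 1 \<and>
      (\<forall>y. y \<in> star_cone G \<and> max_norm y = 1 \<longrightarrow> max_norm (conj_vec y) \<le> max_norm (conj_vec x))" for x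
    by (simp add: best_differentiating_def is_arg_max_linorder one_max_dot max_dot_one)
  have argmax_iff: "is_arg_max D (\<lambda>_. True) k \<longleftrightarrow> (\<forall>j. D j \<le> D k)" for k
    by (simp add: is_arg_max_linorder)
  have M: "0 < ?M j" for j using one_le_max_norm_column by (rule less_le_trans[OF zero_less_one])
  have N: "0 < ?N j" for j
    using max_norm_upper[of "conj_vec (column j G)" j] by (simp add: conj_vec_def column_def diag)
  have s: "?s j \<in> star_cone G" "max_norm (?s j) = 1" "max_norm (conj_vec (?s j)) = D j" for j
    using M[of j] by (simp_all add: star_cone_scaleR column_in_star_cone max_norm_scaleR conj_vec_scaleR D_def)
  have key: "\<exists>k. column k G \<le> x \<and> max_norm (conj_vec x) \<le> ?N k"
    if x: "x \<in> star_cone G" "max_norm x = 1" for x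
  proof -
    obtain k where k: "x $ k = 1" using max_norm_attained[of x] x(2) by metis
    have le: "G $ i $ k \<le> x $ i" for i using star_cone_le[OF x(1), of i k] k by simp
    have "conj_vec x $ i \<le> ?N k" for i
    proof -
      have "conj_vec x $ i \<le> conj_vec (column k G) $ i"
        using le[of i] pos[of i k] by (simp add: conj_vec_def column_def le_imp_inverse_le)
      then show ?thesis using max_norm_upper order_trans by blast
    qed
    then show ?thesis using le by (auto simp: max_norm_le_iff less_eq_vec_def column_def)
  qed
  \<comment> \<open>Normalizing a column multiplies the norm of its conjugate by
    \<open>?M k \<ge> 1\<close>.\<close>
  have N_le_D: "?N k \<le> D k" for k
    using mult_right_mono[OF one_le_max_norm_column[of k] less_imp_le[OF N[of k]]] by (simp add: D_def)
  show ?thesis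
  proof (rule minimal_given_byI)
    have "?S = ?s ` {k. is_arg_max D (\<lambda>_. True) k}" by auto
    then show "finite ?S" by simp
  next
    fix x assume "x \<in> ?S"
    then obtain k where k: "x = ?s k" "\<And>j. D j \<le> D k" using argmax_iff by blast
    have "max_norm (conj_vec y) \<le> D k" if "y \<in> star_cone G" "max_norm y = 1" for y
      using key[OF that] N_le_D k(2) by (meson order_trans)
    then show "best_differentiating (star_cone G) x" using s k by (simp only: best_iff) blast
  next
    fix x assume x: "best_differentiating (star_cone G) x"
    then obtain k where k: "column k G \<le> x" "max_norm (conj_vec x) \<le> ?N k" using key best_iff by blast
    \<comment> \<open>Every normalized column competes with \<open>x\<close>. Together with
      \<open>N_le_D\<close> this makes \<open>D k\<close>, \<open>?N k\<close> and the objective at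
      \<open>x\<close> coincide.\<close>
    have le: "D j \<le> max_norm (conj_vec x)" for j using x s[of j] best_iff by metis
    then have "D j \<le> D k" for j using k(2) N_le_D by (meson order_trans)
    then have "?s k \<in> ?S" using argmax_iff by blast
    have "?s k = column k G"
    proof -
      have "D k \<le> ?N k" using le k(2) by (rule order_trans)
      then have "?M k \<le> 1" using N[of k] by (simp add: D_def)
      then have "?M k = 1" using one_le_max_norm_column by (metis order_antisym)
      then show ?thesis by simp
    qed
    then have "?s k \<le> x" using k(1) by (simp only:)
    then show "\<exists>s\<in>?S. s \<le> x" using \<open>?s k \<in> ?S\<close> by (rule bexI)
  qed
qed

end

text \<open>The conclusions \<open>\<theta> \<noteq> 0\<close> and
  \<open>max_Tr B\<^sub>1 \<le> 1\<close> ensure that \<open>inverse \<theta>\<close> and the star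
  carry their intended meaning.\<close>

theorem theorem9:
  fixes m :: nat
    and C :: "nat \<Rightarrow> real^'n^'n"
    and A B B\<^sub>1 G :: "real^'n^'n"
    and \<theta> :: real
    and g :: "'n \<Rightarrow> real^'n"
    and X :: "(real^'n) set"
  assumes "m \<ge> 1"
    and "\<And>l. l \<in> {1..m} \<Longrightarrow> pairwise_comparison (C l)"
    and "\<And>l. l \<in> {1..m} \<Longrightarrow> max_spectral_radius (C l) \<noteq> 0"
    and "0 \<le> B" and "max_Tr B \<le> 1"
    and "A = max_sum C {1..m}"
    and "\<theta> = theta A B"
    and "B\<^sub>1 = inverse \<theta> *\<^sub>R A \<oplus> B"
    and "G = kleene_star B\<^sub>1"
    and "g = (\<lambda>j. column j G)"
    and "X = {x. max_ordering_solution m C B x}"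
  shows "\<theta> \<noteq> 0 \<and> max_Tr B\<^sub>1 \<le> 1 \<and>
    X = {G \<otimes>v u |u. 0 \<le> u \<and> u \<noteq> 0} \<and>
    minimal_given_by (best_differentiating X)
      {inverse (max_norm (g k)) *\<^sub>R g k |k.
         is_arg_max (\<lambda>j. max_norm (g j) * max_norm (conj_vec (g j))) (\<lambda>_. True) k} \<and>
    greatest_such (worst_differentiating X) (conj_vec (1 v\<otimes> G))"
proof -
  have A_pos: "0 < A $ i $ j" for i j
  proof -
    have "C 1 $ i $ j \<le> A $ i $ j"
      unfolding \<open>A = max_sum C {1..m}\<close> max_sum_def using \<open>m \<ge> 1\<close> by simp
    moreover have "pairwise_comparison (C 1)" using \<open>m \<ge> 1\<close> by (intro assms(2)) simp
    then have "0 < C 1 $ i $ j" unfolding pairwise_comparison_def by blast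
    ultimately show ?thesis by linarith
  qed
  then have A: "0 \<le> A" by (simp add: mat_nonneg_iff less_imp_le)
  have \<theta>: "0 < \<theta>" unfolding \<open>\<theta> = theta A B\<close> using A \<open>0 \<le> B\<close> A_pos by (rule theta_pos)
  have Tr: "max_Tr B\<^sub>1 \<le> 1"
    using max_Tr_max_add_le_one[OF A \<open>0 \<le> B\<close> \<open>max_Tr B \<le> 1\<close>] \<theta>
    unfolding assms(8) \<open>\<theta> = theta A B\<close> by blast
  have B1_pos: "0 < B\<^sub>1 $ i $ j" for i j
    using A_pos \<theta> by (simp add: assms(8) max_add_def less_max_iff_disj)
  then have B1: "0 \<le> B\<^sub>1" by (simp add: mat_nonneg_iff less_imp_le)
  have G_pos: "0 < G $ i $ j" for i j
    using B1_pos le_kleene_star[OF B1 Tr] unfolding assms(9) by (rule less_le_trans)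
  interpret positive_star G
  proof
    show "0 < G $ i $ j" for i j by (rule G_pos)
    show "G $ i $ i = 1" for i unfolding assms(9) by (rule kleene_star_diag[OF B1 Tr])
    \<comment> \<open>Each column of the star is a subsolution for \<open>B\<^sub>1\<close>, hence
      also for the star itself.\<close>
    show "G $ i $ k * G $ k $ j \<le> G $ i $ j" for i k j
    proof -
      have "0 \<le> column j G" using G_pos by (simp add: less_eq_vec_def column_def less_imp_le)
      moreover have "B\<^sub>1 $ i $ k * column j G $ k \<le> column j G $ i" for i k
        unfolding assms(9) column_def by (simp add: kleene_star_mult_upper B1 Tr)
      ultimately show ?thesis
        using kleene_star_subsolution[OF B1, of "column j G" i k] assms(9) by (simp add: column_def)
    qed
  qed
  have "X = star_cone G"
    using max_ordering_solutions_eq[OF \<open>m \<ge> 1\<close> \<open>0 \<le> B\<close> \<open>max_Tr B \<le> 1\<close>, of C] A_pos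
    unfolding assms(11,9,8,7,6) by blast
  then show ?thesis
    using \<theta> Tr star_cone_eq_image minimal_best_differentiating greatest_worst_differentiating
    unfolding assms(10) by (intro conjI) simp_all
qed

end
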